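(* Let $G$ be a structured bilinear SISO system given by $\mathcal{C},\mathcal{K},\mathcal{N},\mathcal{B}$, with subsystem transfer functions $G_k$, and let $\widehat G$, with subsystem transfer functions $\widehat G_k$, be the reduced-order bilinear SISO system constructed by projection with $W,V\in\mathbb{C}^{n\times r}$. Let $\sigma_1,\ldots,\sigma_k\in\mathbb{C}$ be interpolation points at which the matrix functions $\mathcal{C}(s)$, $\mathcal{K}(s)^{-1}$, $\mathcal{N}(s)$ and $\mathcal{B}(s)$ are analytic and $\widehat{\mathcal{K}}(s)$ is full-rank, and let $\ell_1,\ldots,\ell_k\ge 0$ be integers. Let \[ w_{1,j_k}=\partial_{s^{j_k}}(\mathcal{K}^{-\mathsf H}\mathcal{C}^{\mathsf H})(\sigma_k),\qquad j_k=0,\ldots,\ell_k, \] and, for $2\le q\le k$, \[ w_{q,j_{k-q+1}}=\partial_{s^{j_{k-q+1}}}(\mathcal{K}^{-\mathsf H}\mathcal{N}^{\mathsf H})(\sigma_{k-q+1})\Big(\prod_{j=k-q+2}^{k-1}\partial_{s^{\ell_j}}(\mathcal{K}^{-\mathsf H}\mathcal{N}^{\mathsf H})(\sigma_j)\Big)\partial_{s^{\ell_k}}(\mathcal{K}^{-\mathsf H}\mathcal{C}^{\mathsf H})(\sigma_k), \] $j_{k-q+1}=0,\ldots,\ell_{k-q+1}$. Let $W$ be such that $\operatorname{span}(W)\supseteq\operatorname{span}([w_{1,0},\ldots,w_{k,\ell_1}])$ (the span of all the vectors $w_{q,j_{k-q+1}}$, $1\le q\le k$, $0\le j_{k-q+1}\le\ell_{k-q+1}$),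 and let $V$ be an arbitrary full-rank truncation matrix of appropriate dimension. Then \[ \partial_{s_1^{j_k}}G_1(\sigma_k)=\partial_{s_1^{j_k}}\widehat G_1(\sigma_k),\qquad j_k=0,\ldots,\ell_k, \] and, for each $2\le q\le k$, \[ \partial_{s_1^{j_{k-q+1}}s_2^{\ell_{k-q+2}}\cdots s_q^{\ell_k}}G_q(\sigma_{k-q+1},\ldots,\sigma_k)=\partial_{s_1^{j_{k-q+1}}s_2^{\ell_{k-q+2}}\cdots s_q^{\ell_k}}\widehat G_q(\sigma_{k-q+1},\ldots,\sigma_k),\qquad j_{k-q+1}=0,\ldots,\ell_{k-q+1}. \]
   Context: A structured bilinear SISO (single-input single-output) system $G$ is described by matrix-valued functions of a complex variable $\mathcal{C}\colon\mathbb{C}\to\mathbb{C}^{1\times n}$, $\mathcal{K}\colon\mathbb{C}\to\mathbb{C}^{n\times n}$, $\mathcal{N}\colon\mathbb{C}\to\mathbb{C}^{n\times n}$, $\mathcal{B}\colon\mathbb{C}\to\mathbb{C}^{n\times 1}$ (which may fail to be defined, or $\mathcal{K}$ may fail to be invertible, at some points), through its regular subsystem transfer functions \[ G_k(s_1,\ldots,s_k)=\mathcal{C}(s_k)\mathcal{K}(s_k)^{-1}\Big(\prod_{j=1}^{k-1}\mathcal{N}(s_{k-j})\mathcal{K}(s_{k-j})^{-1}\Big)\mathcal{B}(s_1),\qquad k\ge 1 . \] Products $\prod_{j=a}^{b}A_j$ of matrices are ordered $A_aA_{a+1}\cdots A_b$; empty products are identities. Given model reduction bases (truncation matrices) $W,V\in\mathbb{C}^{n\times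 r}$, the reduced-order system $\widehat G$ is given by \[ \widehat{\mathcal{C}}(s)=\mathcal{C}(s)V,\quad \widehat{\mathcal{K}}(s)=W^{\mathsf H}\mathcal{K}(s)V,\quad \widehat{\mathcal{B}}(s)=W^{\mathsf H}\mathcal{B}(s),\quad \widehat{\mathcal{N}}(s)=W^{\mathsf H}\mathcal{N}(s)V, \] and its transfer functions $\widehat G_k$ are defined by the same formula with hatted quantities. Here $^{\mathsf H}$ is the conjugate transpose and $\operatorname{span}$ of a matrix is its column space. Partial (complex) derivatives are denoted by \[ \partial_{s_1^{j_1}\cdots s_k^{j_k}}f(z_1,\ldots,z_k):=\frac{\partial^{j_1+\cdots+j_k}f}{\partial s_1^{j_1}\cdots\partial s_k^{j_k}}(z_1,\ldots,z_k); \] for a function $F$ of a single variable $s$, $\partial_{s^j}F(\sigma)$ is its $j$-th derivative at $\sigma$. Products of matrix functions are pointwise. Derivatives of Hermitian conjugated functions are understood as Hermitian conjugates of derivatives: $\partial_{s^j}(\mathcal{K}^{-\mathsf H}\mathcal{C}^{\mathsf H})(\sigma):=\big(\partial_{s^j}(\mathcal{C}\mathcal{K}^{-1})(\sigma)\big)^{\mathsf H}$ and $\partial_{s^j}(\mathcal{K}^{-\mathsf H}\mathcal{N}^{\mathsf H})(\sigma):=\big(\partial_{s^j}(\mathcal{N}\mathcal{K}^{-1})(\sigma)\big)^{\mathsf H}$. *)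

theory Defs
  imports "HOL-Analysis.Analysis"
begin

definition mat_herm :: "complex^'n^'m \<Rightarrow> complex^'m^'n"
  where "mat_herm A = map_matrix cnj (transpose A)"

text \<open>Ordered product \<open>A a ** A (a + 1) ** \<dots> ** A b\<close>; it is \<open>mat 1\<close> if \<open>b < a\<close>.\<close>

definition mat_prod :: "nat \<Rightarrow> nat \<Rightarrow> (nat \<Rightarrow> complex^'n^'n) \<Rightarrow> complex^'n^'n"
  where "mat_prod a b A = foldr (\<lambda>j P. A j ** P) [a..<Suc b] (mat 1)"

definition full_rank :: "complex^'n^'m \<Rightarrow> bool"
  where "full_rank A \<longleftrightarrow> rank A = min CARD('m) CARD('n)"

definition mat_analytic_at :: "(complex \<Rightarrow> complex^'n^'m) \<Rightarrow> complex \<Rightarrow> bool"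
  where "mat_analytic_at F z \<longleftrightarrow> (\<forall>i j. (\<lambda>s. F s $ i $ j) analytic_on {z})"

text \<open>
  Analyticity of \<open>s \<mapsto> K(s)\<^sup>-\<^sup>1\<close> at \<open>z\<close> includes that the inverse exists near \<open>z\<close>.
  This has to be required explicitly, because \<^const>\<open>matrix_inv\<close> is a total function
  with an unspecified value on singular matrices.
\<close>

definition mat_inv_analytic_at :: "(complex \<Rightarrow> complex^'n^'n) \<Rightarrow> complex \<Rightarrow> bool"
  where "mat_inv_analytic_at K z \<longleftrightarrow>
    (\<forall>\<^sub>F s in nhds z. invertible (K s)) \<and> mat_analytic_at (\<lambda>s. matrix_inv (K s)) z"

definition mat_deriv :: "nat \<Rightarrow> (complex \<Rightarrow> complex^'n^'m) \<Rightarrow> complex \<Rightarrow> complex^'n^'m"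
  where "mat_deriv d F z = (\<chi> i j. (deriv ^^ d) (\<lambda>s. F s $ i $ j) z)"

text \<open>
  A function of \<open>k\<close> complex variables \<open>s\<^sub>1, \<dots>, s\<^sub>k\<close> is represented as a function of
  \<open>s :: nat \<Rightarrow> complex\<close> that only depends on \<open>s 1, \<dots>, s k\<close>.
\<close>

definition partial_deriv ::
    "nat \<Rightarrow> nat \<Rightarrow> ((nat \<Rightarrow> complex) \<Rightarrow> complex) \<Rightarrow> (nat \<Rightarrow> complex) \<Rightarrow> complex"
  where "partial_deriv i d f z = (deriv ^^ d) (\<lambda>t. f (z(i := t))) (z i)"

text \<open>
  \<open>mixed_deriv k d f\<close> is \<open>\<partial>\<^bsup>d 1 + \<dots> + d k\<^esup>f / (\<partial>s\<^sub>1\<^bsup>d 1\<^esup> \<dots> \<partial>s\<^sub>k\<^bsup>d k\<^esup>)\<close>,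
  the derivatives with respect to \<open>s\<^sub>k\<close> being taken first.
\<close>

primrec mixed_deriv ::
    "nat \<Rightarrow> (nat \<Rightarrow> nat) \<Rightarrow> ((nat \<Rightarrow> complex) \<Rightarrow> complex) \<Rightarrow> (nat \<Rightarrow> complex) \<Rightarrow> complex"
  where
    "mixed_deriv 0 d f = f"
  | "mixed_deriv (Suc k) d f = mixed_deriv k d (partial_deriv (Suc k) (d (Suc k)) f)"

text \<open>
  The matrix functions of a system are total here; at points where the original functions are
  undefined their values are arbitrary.
\<close>

record 'n bilinear_siso =
  sysC :: "complex \<Rightarrow> complex^'n^1"
  sysK :: "complex \<Rightarrow> complex^'n^'n"
  sysN :: "complex \<Rightarrow> complex^'n^'n"
  sysB :: "complex \<Rightarrow> complex^1^'n"

definition CK_inv :: "'n::finite bilinear_siso \<Rightarrow> complex \<Rightarrow> complex^'n^1"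
  where "CK_inv G s = sysC G s ** matrix_inv (sysK G s)"

definition NK_inv :: "'n::finite bilinear_siso \<Rightarrow> complex \<Rightarrow> complex^'n^'n"
  where "NK_inv G s = sysN G s ** matrix_inv (sysK G s)"

text \<open>The transfer functions are \<open>1 \<times> 1\<close> matrices, identified with their entry.\<close>

definition transfer :: "'n::finite bilinear_siso \<Rightarrow> nat \<Rightarrow> (nat \<Rightarrow> complex) \<Rightarrow> complex"
  where "transfer G k s =
    (CK_inv G (s k) ** mat_prod 1 (k - 1) (\<lambda>j. NK_inv G (s (k - j))) ** sysB G (s 1)) $ 1 $ 1"

definition project ::
    "complex^'r^'n \<Rightarrow> complex^'r^'n \<Rightarrow> 'n::finite bilinear_siso \<Rightarrow> 'r::finite bilinear_siso"
  where "project W V G =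
    \<lparr> sysC = (\<lambda>s. sysC G s ** V),
      sysK = (\<lambda>s. mat_herm W ** sysK G s ** V),
      sysN = (\<lambda>s. mat_herm W ** sysN G s ** V),
      sysB = (\<lambda>s. mat_herm W ** sysB G s) \<rparr>"

text \<open>
  Derivatives of Hermitian conjugated functions are the Hermitian conjugates of the derivatives:
  \<open>\<partial>\<^bsup>d\<^esup>(K\<^bsup>-H\<^esup> C\<^bsup>H\<^esup>)(z) = (\<partial>\<^bsup>d\<^esup>(C K\<^bsup>-1\<^esup>)(z))\<^bsup>H\<^esup>\<close>, and likewise for \<open>N\<close>.
\<close>

definition deriv_KC_herm :: "'n::finite bilinear_siso \<Rightarrow> nat \<Rightarrow> complex \<Rightarrow> complex^1^'n"
  where "deriv_KC_herm G d z = mat_herm (mat_deriv d (CK_inv G) z)"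

definition deriv_KN_herm :: "'n::finite bilinear_siso \<Rightarrow> nat \<Rightarrow> complex \<Rightarrow> complex^'n^'n"
  where "deriv_KN_herm G d z = mat_herm (mat_deriv d (NK_inv G) z)"

text \<open>
  \<open>left_vec G k \<sigma> l q d\<close> is the vector \<open>w\<^sub>q\<^sub>,\<^sub>d\<close>. The single-variable
  derivatives at \<open>\<sigma> (k - q + 2), \<dots>, \<sigma> k\<close> have the maximal orders given by \<open>l\<close>.
\<close>

definition left_vec ::
    "'n::finite bilinear_siso \<Rightarrow> nat \<Rightarrow> (nat \<Rightarrow> complex) \<Rightarrow> (nat \<Rightarrow> nat) \<Rightarrow> nat \<Rightarrow> nat \<Rightarrow> complex^1^'n"
  where "left_vec G k \<sigma> l q d =
    (if q = 1 then deriv_KC_herm G d (\<sigma> k)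
     else deriv_KN_herm G d (\<sigma> (k - q + 1))
          ** mat_prod (k - q + 2) (k - 1) (\<lambda>j. deriv_KN_herm G (l j) (\<sigma> j))
          ** deriv_KC_herm G (l k) (\<sigma> k))"

end

theory Submission
  imports Defs "HOL-Complex_Analysis.Complex_Analysis"
begin

text \<open>
  Differentiating \<open>G\<^sub>q\<close> in \<open>s\<^sub>q, \<dots>, s\<^sub>2\<close> leaves the constant row
  \<open>w\<^bsub>q-1,l\<^esub>\<^sup>H\<close> in front of \<open>(N K\<^sup>-\<^sup>1 B)(s\<^sub>1)\<close>, so by Leibniz' rule the mixed
  derivative is a combination of the rows \<open>w\<^bsub>q,i\<^esub>\<^sup>H\<close> applied to derivatives of \<open>B\<close>. It
  therefore suffices that the analogous rows \<open>v\<^bsub>q,i\<^esub>\<^sup>H\<close> of the reduced system satisfy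
  \<open>v\<^bsub>q,i\<^esub>\<^sup>H W\<^sup>H = w\<^bsub>q,i\<^esub>\<^sup>H\<close>. With the projection \<open>P = K V (W\<^sup>H K V)\<^sup>-\<^sup>1 W\<^sup>H\<close>, replacing
  \<open>K\<^sup>-\<^sup>1\<close> by \<open>V (W\<^sup>H K V)\<^sup>-\<^sup>1 W\<^sup>H\<close> amounts to multiplying by \<open>P\<close> on the right. Since
  \<open>W\<^sup>H P = W\<^sup>H\<close> is constant, all derivatives of \<open>P\<close> are annihilated by the row space of
  \<open>W\<^sup>H\<close>, which contains every \<open>w\<^bsub>q,i\<^esub>\<^sup>H\<close>.
\<close>

unbundle no Formal_Power_Series.fps_syntax

section \<open>Matrix algebra: conjugate transposes, inverses and column spaces\<close>

lemma mat_herm_mult: "mat_herm (A ** B) = mat_herm B ** mat_herm A"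
  by (simp add: mat_herm_def vec_eq_iff matrix_matrix_mult_def transpose_def mult.commute)

lemma mat_herm_mat_herm [simp]: "mat_herm (mat_herm A) = A"
  by (simp add: mat_herm_def vec_eq_iff transpose_def)

lemma matrix_mult_sum_right:
  fixes B :: "'i \<Rightarrow> complex^'p::finite^'n::finite"
  shows "A ** (\<Sum>i\<in>I. B i) = (\<Sum>i\<in>I. A ** B i)"
  by (induction I rule: infinite_finite_induct) (simp_all add: matrix_add_ldistrib)

lemma matrix_inv_mult:
  assumes "invertible A"
  shows "A ** matrix_inv A = mat 1" "matrix_inv A ** A = mat 1"
  using someI_ex[OF assms[unfolded invertible_def]] unfolding matrix_inv_def by auto

lemma matrix_inv_unique:
  fixes A :: "complex^'n::finite^'n"
  assumes "A ** B = mat 1"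
  shows "matrix_inv A = B"
proof -
  have "invertible A"
    using assms by (auto simp: invertible_right_inverse)
  then have "matrix_inv A ** (A ** B) = B"
    by (simp add: matrix_mul_assoc matrix_inv_mult)
  then show ?thesis
    using assms by simp
qed

lemma full_rank_imp_invertible:
  fixes A :: "complex^'n::finite^'n"
  assumes "full_rank A"
  shows "invertible A"
proof -
  have "vec.dim (rows A) = vec.dimension TYPE(complex) TYPE('n)"
    using assms by (simp add: full_rank_def row_rank_def_gen vec_dim_card vec.dimension_def card_cart_basis)
  then have "vec.span (rows A) = UNIV"
    by (simp add: vec.dim_eq_full)
  then show ?thesis
    by (simp add: invertible_left_inverse matrix_left_invertible_span_rows_gen)
qed

lemma span_columns_eq_range:
  fixes A :: "'a::field^'n^'m"
  shows "vec.span (columns A) = range ((*v) A)"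
proof
  show "range ((*v) A) \<subseteq> vec.span (columns A)"
    using matrix_vector_mult_in_columnspace_gen by blast
  have "column i A = A *v axis i 1" for i
    by (simp add: vec_eq_iff column_def matrix_vector_mult_def axis_def if_distrib cong: if_cong)
  then have "columns A \<subseteq> range ((*v) A)"
    by (auto simp: columns_def)
  moreover have "vec.subspace (range ((*v) A))"
    by (intro vec.subspace_UNIV vec.subspace_image)
  ultimately show "vec.span (columns A) \<subseteq> range ((*v) A)"
    by (rule vec.span_minimal)
qed

lemma columns_subset_span_imp_factor:
  fixes A :: "'a::field^'m::finite^'n::finite" and W :: "'a^'r::finite^'n"
  assumes "columns A \<subseteq> vec.span (columns W)"
  obtains Y where "A = W ** Y"
proof -
  have "\<exists>y. column j A = W *v y" for j
  proof -
    have "column j A \<in> columns A"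
      by (auto simp: columns_def)
    then show ?thesis
      using assms span_columns_eq_range by blast
  qed
  then obtain y where y: "\<And>j. column j A = W *v y j"
    by metis
  have "A = W ** (\<chi> i j. y j $ i)"
    using y by (simp add: vec_eq_iff column_def matrix_vector_mult_def matrix_matrix_mult_def)
  then show ?thesis
    using that by blast
qed

section \<open>Analyticity of matrix functions and of their inverses\<close>

lemma mat_analytic_at_const [intro]: "mat_analytic_at (\<lambda>s. A) z"
  by (simp add: mat_analytic_at_def)

lemma mat_analytic_at_mult [intro]:
  assumes "mat_analytic_at F z" "mat_analytic_at H z"
  shows "mat_analytic_at (\<lambda>s. F s ** H s) z"
  using assms unfolding mat_analytic_at_def matrix_matrix_mult_def
  by (auto intro!: analytic_intros)

lemma mat_analytic_at_cong:
  assumes "\<forall>\<^sub>F s in nhds z. F s = H s"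
  shows "mat_analytic_at F z \<longleftrightarrow> mat_analytic_at H z"
proof -
  have "(\<lambda>s. F s $ i $ j) analytic_on {z} \<longleftrightarrow> (\<lambda>s. H s $ i $ j) analytic_on {z}" for i j
    by (rule analytic_at_cong) (use assms in \<open>auto elim: eventually_mono\<close>)
  then show ?thesis
    by (simp add: mat_analytic_at_def)
qed

lemma analytic_at_det:
  fixes F :: "complex \<Rightarrow> complex^'n::finite^'n"
  assumes "\<And>i j. (\<lambda>s. F s $ i $ j) analytic_on {z}"
  shows "(\<lambda>s. det (F s)) analytic_on {z}"
  unfolding det_def by (intro analytic_intros assms)

text \<open>By Cramer's rule the entries of the inverse are quotients of determinants, hence of
  analytic functions. The denominator is nonzero at \<open>z\<close> and, by continuity, near
  \<open>z\<close>.\<close>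

lemma mat_inv_analytic_at_invertible:
  fixes F :: "complex \<Rightarrow> complex^'n::finite^'n"
  assumes F: "mat_analytic_at F z" and inv: "invertible (F z)"
  shows "mat_inv_analytic_at F z"
proof -
  have F': "(\<lambda>s. F s $ i $ j) analytic_on {z}" for i j
    using F by (simp add: mat_analytic_at_def)
  have det: "(\<lambda>s. det (F s)) analytic_on {z}"
    by (rule analytic_at_det) (rule F')
  have nz: "det (F z) \<noteq> 0"
    using inv by (simp add: invertible_det_nz)
  have "(\<lambda>s. det (F s)) \<midarrow>z\<rightarrow> det (F z)"
    using analytic_at_imp_isCont[OF det] by (simp add: isCont_def)
  then have ev: "\<forall>\<^sub>F s in nhds z. det (F s) \<noteq> 0"
    using tendsto_imp_eventually_ne[OF _ nz] nz by (auto simp: eventually_nhds_conv_at)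
  \<comment> \<open>\<open>M i j s\<close> is \<open>F s\<close> with column \<open>i\<close>
    replaced by the unit vector \<open>axis j 1\<close>: the numerator in Cramer's rule for entry
    \<open>i\<close> of column \<open>j\<close> of the inverse.\<close>
  define M :: "'n \<Rightarrow> 'n \<Rightarrow> complex \<Rightarrow> complex^'n^'n"
    where "M = (\<lambda>i j s. \<chi> i' j'. if j' = i then (axis j 1 :: complex^'n) $ i' else F s $ i' $ j')"
  have entry: "matrix_inv (F s) $ i $ j = det (M i j s) / det (F s)" if s: "det (F s) \<noteq> 0" for s i j
  proof -
    have "F s ** matrix_inv (F s) = mat 1"
      using s by (simp add: matrix_inv_mult invertible_det_nz)
    then have "F s *v column j (matrix_inv (F s)) = axis j 1"
      by (simp add: vec_eq_iff matrix_vector_mult_def matrix_matrix_mult_def column_def mat_def axis_def)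
    then have "column j (matrix_inv (F s)) $ i = det (M i j s) / det (F s)"
      by (subst (asm) cramer[OF s]) (simp add: M_def)
    then show ?thesis
      by (simp add: column_def)
  qed
  have "(\<lambda>s. matrix_inv (F s) $ i $ j) analytic_on {z}" for i j
  proof -
    have "(\<lambda>s. det (M i j s)) analytic_on {z}"
    proof (rule analytic_at_det)
      show "(\<lambda>s. M i j s $ i' $ j') analytic_on {z}" for i' j'
        using F' by (cases "j' = i") (simp_all add: M_def)
    qed
    then have "(\<lambda>s. det (M i j s) / det (F s)) analytic_on {z}"
      using det nz by (intro analytic_intros) auto
    moreover have "\<forall>\<^sub>F s in nhds z. det (M i j s) / det (F s) = matrix_inv (F s) $ i $ j"
      using ev by eventually_elim (simp add: entry)
    ultimately show ?thesis
      using analytic_at_cong[of "\<lambda>s. det (M i j s) / det (F s)" "\<lambda>s. matrix_inv (F s) $ i $ j" z z]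
      by simp
  qed
  then show ?thesis
    using ev by (simp add: mat_inv_analytic_at_def mat_analytic_at_def invertible_det_nz)
qed

text \<open>Near \<open>z\<close>, \<open>K\<close> is the inverse of its own inverse, so the
  previous lemma applied to \<open>matrix_inv (K s)\<close> gives the analyticity of
  \<open>K\<close>, which the projected \<open>K\<close> and the oblique projection require.\<close>

lemma mat_inv_analytic_at_imp_analytic:
  fixes K :: "complex \<Rightarrow> complex^'n::finite^'n"
  assumes "mat_inv_analytic_at K z"
  shows "mat_analytic_at K z"
proof -
  have inv: "\<forall>\<^sub>F s in nhds z. invertible (K s)" and an: "mat_analytic_at (\<lambda>s. matrix_inv (K s)) z"
    using assms by (auto simp: mat_inv_analytic_at_def)
  have "invertible (K z)"
    using inv by (rule eventually_nhds_x_imp_x)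
  then have "invertible (matrix_inv (K z))"
    using matrix_inv_mult invertible_right_inverse by blast
  then have "mat_analytic_at (\<lambda>s. matrix_inv (matrix_inv (K s))) z"
    using mat_inv_analytic_at_invertible[OF an] by (simp add: mat_inv_analytic_at_def)
  moreover have "\<forall>\<^sub>F s in nhds z. matrix_inv (matrix_inv (K s)) = K s"
    using inv by eventually_elim (simp add: matrix_inv_unique matrix_inv_mult)
  ultimately show ?thesis
    using mat_analytic_at_cong[of "\<lambda>s. matrix_inv (matrix_inv (K s))" K z] by simp
qed

section \<open>Derivatives of matrix functions and Leibniz' rule\<close>

lemma higher_deriv_sum_at:
  assumes "\<And>i. i \<in> I \<Longrightarrow> f i analytic_on {z}"
  shows "(deriv ^^ n) (\<lambda>w. \<Sum>i\<in>I. f i w) z = (\<Sum>i\<in>I. (deriv ^^ n) (f i) z)"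
  using assms
proof (induction I rule: infinite_finite_induct)
  case (insert x I)
  then show ?case
    by (simp add: higher_deriv_add_at analytic_on_sum)
qed simp_all

lemma scaleR_matrix_nth:
  fixes A :: "complex^'n^'m"
  shows "(c *\<^sub>R A) $ i $ j = of_real c * A $ i $ j"
  by (subst vector_scaleR_component)+ (rule scaleR_conv_of_real)

text \<open>The scalar Leibniz rule is applied to each entry, and the sums over the inner index and
  over the order are swapped. The order of the factors is kept, since matrices do not
  commute.\<close>

lemma mat_deriv_mult:
  assumes "mat_analytic_at F z" "mat_analytic_at H z"
  shows "mat_deriv n (\<lambda>s. F s ** H s) z =
    (\<Sum>i\<le>n. real (n choose i) *\<^sub>R (mat_deriv i F z ** mat_deriv (n - i) H z))"
proof -
  have F: "(\<lambda>s. F s $ a $ b) analytic_on {z}" for a b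
    using assms by (simp add: mat_analytic_at_def)
  have H: "(\<lambda>s. H s $ a $ b) analytic_on {z}" for a b
    using assms by (simp add: mat_analytic_at_def)
  have "mat_deriv n (\<lambda>s. F s ** H s) z $ a $ b =
      (\<Sum>c\<in>UNIV. \<Sum>i\<le>n. of_nat (n choose i) *
        (deriv ^^ i) (\<lambda>s. F s $ a $ c) z * (deriv ^^ (n - i)) (\<lambda>s. H s $ c $ b) z)" for a b
    by (simp add: mat_deriv_def matrix_matrix_mult_def higher_deriv_sum_at analytic_on_mult F H
        higher_deriv_mult_at atMost_atLeast0)
  also have "\<dots> a b = (\<Sum>i\<le>n. \<Sum>c\<in>UNIV. of_nat (n choose i) *
        (deriv ^^ i) (\<lambda>s. F s $ a $ c) z * (deriv ^^ (n - i)) (\<lambda>s. H s $ c $ b) z)" for a b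
    by (rule sum.swap)
  also have "\<dots> a b =
      (\<Sum>i\<le>n. real (n choose i) *\<^sub>R (mat_deriv i F z ** mat_deriv (n - i) H z)) $ a $ b" for a b
    by (simp add: mat_deriv_def matrix_matrix_mult_def sum_distrib_left mult.assoc scaleR_matrix_nth
        del: vector_scaleR_component)
  finally show ?thesis
    by (simp add: vec_eq_iff)
qed

lemma mat_deriv_const: "mat_deriv n (\<lambda>s. A) z = (if n = 0 then A else 0)"
  by (simp add: mat_deriv_def vec_eq_iff)

lemma mat_deriv_cmult_left:
  assumes "mat_analytic_at F z"
  shows "mat_deriv n (\<lambda>s. A ** F s) z = A ** mat_deriv n F z"
proof -
  have "mat_deriv n (\<lambda>s. A ** F s) z =
      (\<Sum>i\<le>n. real (n choose i) *\<^sub>R (mat_deriv i (\<lambda>s. A) z ** mat_deriv (n - i) F z))"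
    by (rule mat_deriv_mult[OF mat_analytic_at_const assms])
  also have "\<dots> = (\<Sum>i\<le>n. if i = 0 then A ** mat_deriv n F z else 0)"
    by (rule sum.cong) (auto simp: mat_deriv_const)
  finally show ?thesis
    by simp
qed

lemma mat_deriv_cmult_right:
  assumes "mat_analytic_at F z"
  shows "mat_deriv n (\<lambda>s. F s ** A) z = mat_deriv n F z ** A"
proof -
  have "mat_deriv n (\<lambda>s. F s ** A) z =
      (\<Sum>i\<le>n. real (n choose i) *\<^sub>R (mat_deriv i F z ** mat_deriv (n - i) (\<lambda>s. A) z))"
    by (rule mat_deriv_mult[OF assms mat_analytic_at_const])
  also have "\<dots> = (\<Sum>i\<le>n. if i = n then mat_deriv n F z ** A else 0)"
    by (rule sum.cong) (auto simp: mat_deriv_const)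
  finally show ?thesis
    by simp
qed

lemma mat_deriv_cong:
  assumes "\<forall>\<^sub>F s in nhds z. F s = H s"
  shows "mat_deriv n F z = mat_deriv n H z"
proof -
  have "(deriv ^^ n) (\<lambda>s. F s $ i $ j) z = (deriv ^^ n) (\<lambda>s. H s $ i $ j) z" for i j
    by (rule higher_deriv_cong_ev) (use assms in \<open>auto elim: eventually_mono\<close>)
  then show ?thesis
    by (simp add: mat_deriv_def)
qed

text \<open>
  Only the Leibniz term with \<open>P\<close> undifferentiated survives, because \<open>U P = U\<close> is constant.
\<close>

lemma mat_deriv_mult_projection:
  fixes F :: "complex \<Rightarrow> complex^'n::finite^'p::finite" and U :: "complex^'n^'r::finite"
    and c :: "complex^'p^'m::finite"
  assumes F: "mat_analytic_at F z" and P: "mat_analytic_at P z"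
    and UP: "\<forall>\<^sub>F s in nhds z. U ** P s = U"
    and row: "\<And>i. i \<le> d \<Longrightarrow> c ** mat_deriv i F z = y i ** U"
  shows "c ** mat_deriv d (\<lambda>s. F s ** P s) z = c ** mat_deriv d F z"
proof -
  have "U ** mat_deriv i P z = mat_deriv i (\<lambda>s. U) z" for i
    using mat_deriv_cmult_left[OF P, of i U] mat_deriv_cong[OF UP, of i] by simp
  then have U: "U ** mat_deriv i P z = (if i = 0 then U else 0)" for i
    by (simp add: mat_deriv_const)
  have "c ** mat_deriv d (\<lambda>s. F s ** P s) z =
      (\<Sum>i\<le>d. real (d choose i) *\<^sub>R (c ** mat_deriv i F z ** mat_deriv (d - i) P z))"
    by (simp add: mat_deriv_mult[OF F P] matrix_mult_sum_right matrix_scalar_ac matrix_mul_assoc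
        scalar_matrix_assoc)
  also have "\<dots> = (\<Sum>i\<le>d. if i = d then y d ** U else 0)"
  proof (rule sum.cong)
    fix i assume "i \<in> {..d}"
    then have "c ** mat_deriv i F z ** mat_deriv (d - i) P z = y i ** (U ** mat_deriv (d - i) P z)"
      by (simp add: row matrix_mul_assoc)
    then show "real (d choose i) *\<^sub>R (c ** mat_deriv i F z ** mat_deriv (d - i) P z) =
        (if i = d then y d ** U else 0)"
      using \<open>i \<in> {..d}\<close> by (auto simp: U)
  qed simp
  also have "\<dots> = c ** mat_deriv d F z"
    by (simp add: row)
  finally show ?thesis .
qed

section \<open>Ordered products and mixed partial derivatives\<close>

lemma mat_prod_empty: "b < a \<Longrightarrow> mat_prod a b A = mat 1"
  by (simp add: mat_prod_def)

lemma mat_prod_rec: "a \<le> b \<Longrightarrow> mat_prod a b A = A a ** mat_prod (Suc a) b A"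
  by (simp add: mat_prod_def upt_rec[of a])

lemma mat_prod_shift: "mat_prod (Suc a) (Suc b) A = mat_prod a b (\<lambda>j. A (Suc j))"
  by (simp add: mat_prod_def map_Suc_upt[symmetric] foldr_map o_def del: upt_Suc)

lemma mat_prod_rec_shift:
  "a \<le> Suc b \<Longrightarrow> mat_prod a (Suc b) A = A a ** mat_prod a b (\<lambda>j. A (Suc j))"
  by (simp only: mat_prod_rec mat_prod_shift)

lemma mat_prod_cong:
  assumes "\<And>j. a \<le> j \<Longrightarrow> j \<le> b \<Longrightarrow> A j = A' j"
  shows "mat_prod a b A = mat_prod a b A'"
  unfolding mat_prod_def by (rule foldr_cong) (use assms in auto)

text \<open>Differentiation in the first \<open>m\<close> variables never moves the later
  coordinates, so agreement is needed only where these equal those of \<open>z\<close>. This allows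
  variables already differentiated to be frozen at their nodes.\<close>

lemma mixed_deriv_cong:
  assumes "\<And>s. (\<And>i. i > m \<Longrightarrow> s i = z i) \<Longrightarrow> f s = g s"
  shows "mixed_deriv m d f z = mixed_deriv m d g z"
  using assms
proof (induction m arbitrary: f g)
  case (Suc m)
  have "partial_deriv (Suc m) (d (Suc m)) f s = partial_deriv (Suc m) (d (Suc m)) g s"
    if "\<And>i. i > m \<Longrightarrow> s i = z i" for s
  proof -
    have "(\<lambda>t. f (s(Suc m := t))) = (\<lambda>t. g (s(Suc m := t)))"
      using that by (intro ext Suc.prems) auto
    then show ?thesis
      by (simp add: partial_deriv_def)
  qed
  then show ?case
    unfolding mixed_deriv.simps by (rule Suc.IH)
qed simp

text \<open>Of the three factors only \<open>X\<close> depends on the last variable, so the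
  derivative taken first acts on \<open>X\<close> alone. The condition \<open>m \<ge> 1\<close>
  keeps the argument \<open>s 1\<close> of \<open>B\<close> distinct from that variable.\<close>

lemma mixed_deriv_Suc_chain:
  fixes X :: "complex \<Rightarrow> complex^'n::finite^1"
  assumes X: "mat_analytic_at X (z (Suc m))" and "m \<ge> 1"
  shows "mixed_deriv (Suc m) d
      (\<lambda>s. (X (s (Suc m)) ** mat_prod 1 m (\<lambda>j. N (s (Suc m - j))) ** B (s 1)) $ 1 $ 1) z =
    mixed_deriv m d
      (\<lambda>s. (mat_deriv (d (Suc m)) X (z (Suc m))
        ** mat_prod 1 m (\<lambda>j. N (s (Suc m - j))) ** B (s 1)) $ 1 $ 1) z"
proof -
  have "partial_deriv (Suc m) (d (Suc m))
      (\<lambda>s. (X (s (Suc m)) ** mat_prod 1 m (\<lambda>j. N (s (Suc m - j))) ** B (s 1)) $ 1 $ 1) s =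
    (mat_deriv (d (Suc m)) X (z (Suc m))
        ** mat_prod 1 m (\<lambda>j. N (s (Suc m - j))) ** B (s 1)) $ 1 $ 1"
    if "\<And>i. i > m \<Longrightarrow> s i = z i" for s
  proof -
    let ?R = "mat_prod 1 m (\<lambda>j. N (s (Suc m - j))) ** B (s 1)"
    \<comment> \<open>The product index starts at 1, so \<open>Suc m - j\<close> is at most
      \<open>m\<close> and the updated coordinate is never read.\<close>
    have "mat_prod 1 m (\<lambda>j. N ((s(Suc m := t)) (Suc m - j))) =
        mat_prod 1 m (\<lambda>j. N (s (Suc m - j)))" for t
      by (rule mat_prod_cong) auto
    then have "partial_deriv (Suc m) (d (Suc m))
      (\<lambda>s. (X (s (Suc m)) ** mat_prod 1 m (\<lambda>j. N (s (Suc m - j))) ** B (s 1)) $ 1 $ 1) s =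
      mat_deriv (d (Suc m)) (\<lambda>t. X t ** ?R) (z (Suc m)) $ 1 $ 1"
      using \<open>m \<ge> 1\<close> that by (simp add: partial_deriv_def mat_deriv_def matrix_mul_assoc)
    also have "mat_deriv (d (Suc m)) (\<lambda>t. X t ** ?R) (z (Suc m)) =
        mat_deriv (d (Suc m)) X (z (Suc m)) ** ?R"
      by (rule mat_deriv_cmult_right[OF X])
    finally show ?thesis
      by (simp only: matrix_mul_assoc)
  qed
  then show ?thesis
    unfolding mixed_deriv.simps by (rule mixed_deriv_cong)
qed

section \<open>The rows produced by differentiating the transfer functions\<close>

lemma left_vec_Suc:
  assumes "1 \<le> q" "q < k"
  shows "left_vec G k \<sigma> l (Suc q) d =
    deriv_KN_herm G d (\<sigma> (k - q)) ** left_vec G k \<sigma> l q (l (k - q + 1))"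
proof (cases "q = 1")
  case True
  \<comment> \<open>Here the product in \<open>left_vec G k \<sigma> l 2 d\<close> runs from
    \<open>k\<close> to \<open>k - 1\<close> and is empty.\<close>
  then show ?thesis
    using assms by (simp add: left_vec_def mat_prod_empty Suc_diff_Suc)
next
  case False
  then have "mat_prod (k - q + 1) (k - 1) (\<lambda>j. deriv_KN_herm G (l j) (\<sigma> j)) =
      deriv_KN_herm G (l (k - q + 1)) (\<sigma> (k - q + 1)) **
      mat_prod (k - q + 2) (k - 1) (\<lambda>j. deriv_KN_herm G (l j) (\<sigma> j))"
    using assms by (subst mat_prod_rec) auto
  moreover have "k - Suc q + 1 = k - q" "k - Suc q + 2 = k - q + 1"
    using assms by auto
  ultimately show ?thesis
    using assms False by (simp add: left_vec_def matrix_mul_assoc)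
qed

text \<open>Conjugate transposition undoes the Hermitian convention for the derivatives: new factors
  are appended on the right, in the order of the transfer function, and are plain derivatives of
  \<open>CK_inv\<close> and \<open>NK_inv\<close>.\<close>

definition left_row ::
    "'n::finite bilinear_siso \<Rightarrow> nat \<Rightarrow> (nat \<Rightarrow> complex) \<Rightarrow> (nat \<Rightarrow> nat) \<Rightarrow> nat \<Rightarrow> nat \<Rightarrow> complex^'n^1"
  where "left_row G k \<sigma> l q d = mat_herm (left_vec G k \<sigma> l q d)"

lemma left_row_1: "left_row G k \<sigma> l (Suc 0) d = mat_deriv d (CK_inv G) (\<sigma> k)"
  by (simp add: left_row_def left_vec_def deriv_KC_herm_def)

lemma left_row_Suc:
  assumes "1 \<le> q" "q < k"
  shows "left_row G k \<sigma> l (Suc q) d =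
    left_row G k \<sigma> l q (l (k - q + 1)) ** mat_deriv d (NK_inv G) (\<sigma> (k - q))"
  by (simp add: left_row_def left_vec_Suc[OF assms] mat_herm_mult deriv_KN_herm_def)

text \<open>Induction on the number \<open>p\<close> of variables already differentiated: each one
  turns the leading nonconstant factor into a constant, and these accumulate to
  \<open>left_row\<close> at maximal order. It stops before \<open>s 1\<close>, which also occurs in
  \<open>sysB\<close> and whose order is free.\<close>

lemma mixed_deriv_transfer_unroll:
  fixes G :: "'n::finite bilinear_siso"
  assumes C: "\<And>i. i \<in> {1..k} \<Longrightarrow> mat_analytic_at (CK_inv G) (\<sigma> i)"
    and N: "\<And>i. i \<in> {1..k} \<Longrightarrow> mat_analytic_at (NK_inv G) (\<sigma> i)"
    and z: "\<And>i. i \<in> {1..q} \<Longrightarrow> z i = \<sigma> (k - q + i)"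
    and e: "\<And>i. i \<in> {2..q} \<Longrightarrow> e i = l (k - q + i)"
    and "q \<le> k" and "1 \<le> p" and "p < q"
  shows "mixed_deriv q e (transfer G q) z =
    mixed_deriv (q - p) e (\<lambda>s. (left_row G k \<sigma> l p (l (k - p + 1)) **
      mat_prod 1 (q - p) (\<lambda>j. NK_inv G (s (Suc (q - p) - j))) ** sysB G (s 1)) $ 1 $ 1) z"
  using \<open>1 \<le> p\<close> \<open>p < q\<close>
proof (induction p rule: nat_induct_at_least)
  case base
  then obtain m where m: "q = Suc m" "m \<ge> 1"
    by (cases q) auto
  have zk: "z (Suc m) = \<sigma> k" and ek: "e (Suc m) = l k"
    using z[of q] e[of q] m \<open>q \<le> k\<close> by auto
  have "transfer G q = (\<lambda>s. (CK_inv G (s (Suc m)) **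
      mat_prod 1 m (\<lambda>j. NK_inv G (s (Suc m - j))) ** sysB G (s 1)) $ 1 $ 1)"
    by (simp add: transfer_def fun_eq_iff m)
  moreover have "mat_analytic_at (CK_inv G) (z (Suc m))"
    using C[of k] zk m \<open>q \<le> k\<close> by simp
  ultimately show ?case
    using mixed_deriv_Suc_chain[of "CK_inv G" z m e "NK_inv G" "sysB G"] m \<open>q \<le> k\<close>
    by (simp add: zk ek left_row_1)
next
  case (Suc p)
  \<comment> \<open>After this step \<open>m\<close> variables remain; the one differentiated now is
    number \<open>Suc m\<close>, with node \<open>\<sigma> (k - p)\<close>.\<close>
  define m where "m = q - Suc p"
  then have m: "q - p = Suc m" "m \<ge> 1"
    using Suc.prems by auto
  let ?c = "left_row G k \<sigma> l p (l (k - p + 1))"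
  have idx: "k - q + Suc m = k - p" "Suc m \<in> {2..q}" "k - p \<in> {1..k}" "1 \<le> p" "p < k"
    "k - Suc p + 1 = k - p"
    using m Suc.prems Suc.hyps \<open>q \<le> k\<close> by auto
  have zk: "z (Suc m) = \<sigma> (k - p)" and ek: "e (Suc m) = l (k - p)"
    using z[of "Suc m"] e[of "Suc m"] idx by auto
  have X: "mat_analytic_at (NK_inv G) (\<sigma> (k - p))"
    by (rule N) fact
  have "mixed_deriv q e (transfer G q) z = mixed_deriv (Suc m) e (\<lambda>s. (?c **
      mat_prod 1 (Suc m) (\<lambda>j. NK_inv G (s (Suc (Suc m) - j))) ** sysB G (s 1)) $ 1 $ 1) z"
    using Suc m by simp
  \<comment> \<open>The first factor of the product is the only one containing
    \<open>s (Suc m)\<close>; it joins the constant row to form the \<open>X\<close> of the chain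
    lemma.\<close>
  also have "\<dots> = mixed_deriv (Suc m) e (\<lambda>s. (?c ** NK_inv G (s (Suc m)) **
      mat_prod 1 m (\<lambda>j. NK_inv G (s (Suc m - j))) ** sysB G (s 1)) $ 1 $ 1) z"
    by (simp add: mat_prod_rec_shift matrix_mul_assoc)
  also have "\<dots> = mixed_deriv m e (\<lambda>s. (mat_deriv (l (k - p)) (\<lambda>t. ?c ** NK_inv G t) (\<sigma> (k - p)) **
      mat_prod 1 m (\<lambda>j. NK_inv G (s (Suc m - j))) ** sysB G (s 1)) $ 1 $ 1) z"
    using mixed_deriv_Suc_chain[of "\<lambda>t. ?c ** NK_inv G t" z m e "NK_inv G" "sysB G"] m(2)
      mat_analytic_at_mult[OF mat_analytic_at_const X]
    unfolding zk ek by blast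
  also have "mat_deriv (l (k - p)) (\<lambda>t. ?c ** NK_inv G t) (\<sigma> (k - p)) =
      left_row G k \<sigma> l (Suc p) (l (k - p))"
    using idx by (simp add: mat_deriv_cmult_left[OF X] left_row_Suc)
  finally show ?case
    using idx by (simp only: m_def[symmetric])
qed

text \<open>Once all variables but \<open>s 1\<close> are differentiated, a product of two functions
  of \<open>s 1\<close> remains, to which Leibniz' rule applies.\<close>

lemma mixed_deriv_transfer:
  fixes G :: "'n::finite bilinear_siso"
  assumes C: "\<And>i. i \<in> {1..k} \<Longrightarrow> mat_analytic_at (CK_inv G) (\<sigma> i)"
    and N: "\<And>i. i \<in> {1..k} \<Longrightarrow> mat_analytic_at (NK_inv G) (\<sigma> i)"
    and B: "\<And>i. i \<in> {1..k} \<Longrightarrow> mat_analytic_at (sysB G) (\<sigma> i)"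
    and z: "\<And>i. i \<in> {1..q} \<Longrightarrow> z i = \<sigma> (k - q + i)"
    and e: "\<And>i. i \<in> {2..q} \<Longrightarrow> e i = l (k - q + i)"
    and "q \<le> k" and "1 \<le> q"
  shows "mixed_deriv q e (transfer G q) z =
    (\<Sum>i\<le>e 1. real (e 1 choose i) *\<^sub>R
      (left_row G k \<sigma> l q i ** mat_deriv (e 1 - i) (sysB G) (\<sigma> (k - q + 1)))) $ 1 $ 1"
proof -
  have z1: "z 1 = \<sigma> (k - q + 1)"
    using z[of 1] \<open>1 \<le> q\<close> by simp
  have *: "k - q + 1 \<in> {1..k}"
    using \<open>q \<le> k\<close> \<open>1 \<le> q\<close> by auto
  \<comment> \<open>\<open>X\<close> is everything in front of \<open>sysB\<close> as a function of
    the last remaining variable; its derivative of order \<open>i\<close> is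
    \<open>left_row G k \<sigma> l q i\<close>.\<close>
  define X where "X = (if q = 1 then CK_inv G
    else (\<lambda>t. left_row G k \<sigma> l (q - 1) (l (k - q + 2)) ** NK_inv G t))"
  have X: "mat_analytic_at X (\<sigma> (k - q + 1))"
    using C[OF *] N[OF *] by (auto simp: X_def)
  have deriv_X: "mat_deriv i X (\<sigma> (k - q + 1)) = left_row G k \<sigma> l q i" for i
  proof (cases "q = 1")
    case True
    then show ?thesis
      using \<open>q \<le> k\<close> by (simp add: X_def left_row_1)
  next
    case False
    then have "Suc (q - 1) = q" "k - (q - 1) = k - q + 1" "k - (q - 1) + 1 = k - q + 2"
      using \<open>q \<le> k\<close> \<open>1 \<le> q\<close> by auto
    then show ?thesis
      using False \<open>q \<le> k\<close> \<open>1 \<le> q\<close> left_row_Suc[of "q - 1" k G \<sigma> l i]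
      by (simp add: X_def mat_deriv_cmult_left[OF N[OF *, unfolded One_nat_def add_Suc_right add_0_right]])
  qed
  have "mixed_deriv q e (transfer G q) z = mixed_deriv 1 e (\<lambda>s. (X (s 1) ** sysB G (s 1)) $ 1 $ 1) z"
  proof (cases "q = 1")
    case True
    then show ?thesis
      by (simp add: X_def transfer_def[abs_def] mat_prod_empty)
  next
    case False
    then have "q - (q - 1) = 1" "k - (q - 1) + 1 = k - q + 2" "1 \<le> q - 1" "q - 1 < q"
      using \<open>q \<le> k\<close> \<open>1 \<le> q\<close> by auto
    then show ?thesis
      using False mixed_deriv_transfer_unroll[where p = "q - 1" and z = z and e = e, OF C N z e \<open>q \<le> k\<close>]
      by (simp add: X_def mat_prod_rec mat_prod_empty matrix_mul_assoc)
  qed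
  also have "\<dots> = mat_deriv (e 1) (\<lambda>t. X t ** sysB G t) (\<sigma> (k - q + 1)) $ 1 $ 1"
    using z1 by (simp add: partial_deriv_def mat_deriv_def)
  finally show ?thesis
    by (simp only: mat_deriv_mult[OF X B[OF *]] deriv_X)
qed

section \<open>The oblique projection and the rows of the reduced system\<close>

definition oblique_proj :: "complex^'r::finite^'n::finite \<Rightarrow> complex^'r^'n \<Rightarrow> complex^'n^'n \<Rightarrow> complex^'n^'n"
  where "oblique_proj W V K = K ** V ** matrix_inv (mat_herm W ** K ** V) ** mat_herm W"

text \<open>Cancelling \<open>K^-1 K\<close> shows that \<open>V (W^H K V)^-1 W^H\<close> equals
  \<open>K^-1 P\<close>. The reduced \<open>N\<close> carries an additional \<open>W^H\<close> on
  its left, which the preceding row will absorb.\<close>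

lemma project_inv_mult_herm:
  fixes G :: "'n::finite bilinear_siso" and W V :: "complex^'r::finite^'n"
  assumes "invertible (sysK G s)"
  shows "CK_inv (project W V G) s ** mat_herm W = CK_inv G s ** oblique_proj W V (sysK G s)"
    and "NK_inv (project W V G) s ** mat_herm W =
      mat_herm W ** (NK_inv G s ** oblique_proj W V (sysK G s))"
proof -
  have *: "A ** matrix_inv (sysK G s) ** oblique_proj W V (sysK G s) =
      A ** V ** matrix_inv (mat_herm W ** sysK G s ** V) ** mat_herm W" for A :: "complex^'n^'m::finite"
  proof -
    have "A ** matrix_inv (sysK G s) ** oblique_proj W V (sysK G s) =
      A ** (matrix_inv (sysK G s) ** sysK G s) ** V ** matrix_inv (mat_herm W ** sysK G s ** V)
        ** mat_herm W"
      by (simp only: oblique_proj_def matrix_mul_assoc)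
    then show ?thesis
      by (simp add: matrix_inv_mult[OF assms])
  qed
  show "CK_inv (project W V G) s ** mat_herm W = CK_inv G s ** oblique_proj W V (sysK G s)"
    unfolding CK_inv_def * by (simp add: project_def)
  show "NK_inv (project W V G) s ** mat_herm W =
      mat_herm W ** (NK_inv G s ** oblique_proj W V (sysK G s))"
    unfolding NK_inv_def * by (simp add: project_def matrix_mul_assoc)
qed

text \<open>\<open>P\<close> is the projection onto the range of \<open>K V\<close> along the kernel
  of \<open>W^H\<close>, so \<open>W^H\<close> annihilates \<open>I - P\<close>.\<close>

lemma herm_mult_oblique_proj:
  assumes "invertible (mat_herm W ** K ** V)"
  shows "mat_herm W ** oblique_proj W V K = mat_herm W"
proof -
  have "mat_herm W ** oblique_proj W V K =
      (mat_herm W ** K ** V) ** matrix_inv (mat_herm W ** K ** V) ** mat_herm W"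
    by (simp only: oblique_proj_def matrix_mul_assoc)
  then show ?thesis
    by (simp add: matrix_inv_mult[OF assms])
qed

text \<open>Full rank is assumed only at \<open>z\<close>, but invertibility is an open condition
  for the analytic \<open>W^H K V\<close>. Hence the last identity holds near \<open>z\<close> and
  can be differentiated.\<close>

lemma project_analytic_at:
  fixes G :: "'n::finite bilinear_siso" and W V :: "complex^'r::finite^'n"
  assumes C: "mat_analytic_at (sysC G) z" and K: "mat_inv_analytic_at (sysK G) z"
    and N: "mat_analytic_at (sysN G) z" and B: "mat_analytic_at (sysB G) z"
    and rank: "full_rank (sysK (project W V G) z)"
  shows "mat_analytic_at (CK_inv G) z" "mat_analytic_at (NK_inv G) z"
    and "mat_analytic_at (CK_inv (project W V G)) z" "mat_analytic_at (NK_inv (project W V G)) z"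
    and "mat_analytic_at (sysB (project W V G)) z"
    and "mat_analytic_at (\<lambda>s. oblique_proj W V (sysK G s)) z"
    and "\<forall>\<^sub>F s in nhds z. mat_herm W ** oblique_proj W V (sysK G s) = mat_herm W"
proof -
  have K1: "mat_analytic_at (\<lambda>s. matrix_inv (sysK G s)) z"
    using K by (simp add: mat_inv_analytic_at_def)
  have K2: "mat_analytic_at (sysK G) z"
    using K by (rule mat_inv_analytic_at_imp_analytic)
  have "mat_inv_analytic_at (\<lambda>s. mat_herm W ** sysK G s ** V) z"
    using rank by (intro mat_inv_analytic_at_invertible mat_analytic_at_mult mat_analytic_at_const K2
      full_rank_imp_invertible) (simp add: project_def)
  then have K3: "mat_analytic_at (\<lambda>s. matrix_inv (mat_herm W ** sysK G s ** V)) z"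
    and K4: "\<forall>\<^sub>F s in nhds z. invertible (mat_herm W ** sysK G s ** V)"
    by (auto simp: mat_inv_analytic_at_def)
  note intros = mat_analytic_at_mult mat_analytic_at_const C N B K1 K2 K3
  show "mat_analytic_at (CK_inv G) z" "mat_analytic_at (NK_inv G) z"
    unfolding CK_inv_def[abs_def] NK_inv_def[abs_def] by (intro intros)+
  show "mat_analytic_at (CK_inv (project W V G)) z" "mat_analytic_at (NK_inv (project W V G)) z"
    unfolding CK_inv_def[abs_def] NK_inv_def[abs_def] project_def bilinear_siso.simps
    by (intro intros)+
  show "mat_analytic_at (sysB (project W V G)) z"
    unfolding project_def bilinear_siso.simps by (intro intros)
  show "mat_analytic_at (\<lambda>s. oblique_proj W V (sysK G s)) z"
    unfolding oblique_proj_def by (intro intros)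
  show "\<forall>\<^sub>F s in nhds z. mat_herm W ** oblique_proj W V (sysK G s) = mat_herm W"
    using K4 by eventually_elim (rule herm_mult_oblique_proj)
qed

text \<open>Induction on \<open>q\<close>. The trailing \<open>W^H\<close> moves through the newest
  factor, leaving \<open>P\<close> on the right and \<open>W^H\<close> on the left; the induction
  hypothesis turns the reduced row times \<open>W^H\<close> into the original row, and the
  derivatives of \<open>P\<close> drop out.\<close>

lemma left_row_project:
  fixes G :: "'n::finite bilinear_siso" and W V :: "complex^'r::finite^'n"
  assumes C: "\<And>i. i \<in> {1..k} \<Longrightarrow> mat_analytic_at (sysC G) (\<sigma> i)"
    and K: "\<And>i. i \<in> {1..k} \<Longrightarrow> mat_inv_analytic_at (sysK G) (\<sigma> i)"
    and N: "\<And>i. i \<in> {1..k} \<Longrightarrow> mat_analytic_at (sysN G) (\<sigma> i)"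
    and B: "\<And>i. i \<in> {1..k} \<Longrightarrow> mat_analytic_at (sysB G) (\<sigma> i)"
    and rank: "\<And>i. i \<in> {1..k} \<Longrightarrow> full_rank (sysK (project W V G) (\<sigma> i))"
    and y: "\<And>q d. q \<in> {1..k} \<Longrightarrow> d \<le> l (k - q + 1) \<Longrightarrow>
      left_row G k \<sigma> l q d = y q d ** mat_herm W"
    and "1 \<le> q" "q \<le> k" "d \<le> l (k - q + 1)"
  shows "left_row (project W V G) k \<sigma> l q d ** mat_herm W = left_row G k \<sigma> l q d"
  using \<open>1 \<le> q\<close> \<open>q \<le> k\<close> \<open>d \<le> l (k - q + 1)\<close>
proof (induction q arbitrary: d rule: nat_induct_at_least)
  case base
  then have k: "k \<in> {1..k}" "k - 1 + 1 = k"
    by auto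
  note an = project_analytic_at[OF C K N B rank, OF k(1) k(1) k(1) k(1) k(1)]
  have inv: "\<forall>\<^sub>F s in nhds (\<sigma> k). invertible (sysK G s)"
    using K[OF k(1)] by (simp add: mat_inv_analytic_at_def)
  have ev: "\<forall>\<^sub>F s in nhds (\<sigma> k). CK_inv (project W V G) s ** mat_herm W =
      CK_inv G s ** oblique_proj W V (sysK G s)"
    using inv by eventually_elim (rule project_inv_mult_herm)
  have "mat_deriv d (CK_inv (project W V G)) (\<sigma> k) ** mat_herm W =
      mat 1 ** mat_deriv d (\<lambda>s. CK_inv G s ** oblique_proj W V (sysK G s)) (\<sigma> k)"
    using mat_deriv_cong[OF ev] by (simp add: mat_deriv_cmult_right[OF an(3)])
  also have "\<dots> = mat 1 ** mat_deriv d (CK_inv G) (\<sigma> k)"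
    using y[of 1] base k
    by (intro mat_deriv_mult_projection[OF an(1,6,7), where y = "y 1"]) (simp add: left_row_1)
  finally show ?case
    by (simp add: left_row_1)
next
  case (Suc q)
  have q: "1 \<le> q" "q < k" "k - q \<in> {1..k}" "Suc q \<in> {1..k}" "k - Suc q + 1 = k - q"
    using Suc by auto
  note an = project_analytic_at[OF C K N B rank, OF q(3) q(3) q(3) q(3) q(3)]
  have inv: "\<forall>\<^sub>F s in nhds (\<sigma> (k - q)). invertible (sysK G s)"
    using K[OF q(3)] by (simp add: mat_inv_analytic_at_def)
  have ev: "\<forall>\<^sub>F s in nhds (\<sigma> (k - q)). NK_inv (project W V G) s ** mat_herm W =
      mat_herm W ** (NK_inv G s ** oblique_proj W V (sysK G s))"
    using inv by eventually_elim (rule project_inv_mult_herm)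
  let ?v = "left_row (project W V G) k \<sigma> l q (l (k - q + 1))"
  let ?w = "left_row G k \<sigma> l q (l (k - q + 1))"
  have IH: "?v ** mat_herm W = ?w"
    by (rule Suc.IH) (use q in auto)
  have "left_row (project W V G) k \<sigma> l (Suc q) d ** mat_herm W =
      ?v ** (mat_deriv d (NK_inv (project W V G)) (\<sigma> (k - q)) ** mat_herm W)"
    using q by (simp add: left_row_Suc matrix_mul_assoc)
  also have "mat_deriv d (NK_inv (project W V G)) (\<sigma> (k - q)) ** mat_herm W =
      mat_herm W ** mat_deriv d (\<lambda>s. NK_inv G s ** oblique_proj W V (sysK G s)) (\<sigma> (k - q))"
    using mat_deriv_cong[OF ev] mat_deriv_cmult_left[OF mat_analytic_at_mult[OF an(2,6)]]
    by (simp add: mat_deriv_cmult_right[OF an(4)])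
  also have "?v ** \<dots> = ?w ** mat_deriv d (\<lambda>s. NK_inv G s ** oblique_proj W V (sysK G s)) (\<sigma> (k - q))"
    by (simp only: matrix_mul_assoc IH)
  \<comment> \<open>Leibniz' rule involves every order \<open>i \<le> d\<close>, so all the rows
    with these orders must lie in the row space of \<open>W^H\<close>.\<close>
  also have "\<dots> = ?w ** mat_deriv d (NK_inv G) (\<sigma> (k - q))"
  proof (rule mat_deriv_mult_projection[OF an(2,6,7)])
    show "?w ** mat_deriv i (NK_inv G) (\<sigma> (k - q)) = y (Suc q) i ** mat_herm W" if "i \<le> d" for i
      using y[of "Suc q" i] that Suc.prems q by (simp add: left_row_Suc)
  qed
  also have "\<dots> = left_row G k \<sigma> l (Suc q) d"
    using q by (simp add: left_row_Suc)
  finally show ?case .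
qed

theorem theorem5:
  fixes G :: "'n::finite bilinear_siso"
    and W V :: "complex^'r::finite^'n"
    and k :: nat
    and \<sigma> :: "nat \<Rightarrow> complex"
    and l :: "nat \<Rightarrow> nat"
  assumes "k \<ge> 1"
    and "\<And>i. i \<in> {1..k} \<Longrightarrow> mat_analytic_at (sysC G) (\<sigma> i)"
    and "\<And>i. i \<in> {1..k} \<Longrightarrow> mat_inv_analytic_at (sysK G) (\<sigma> i)"
    and "\<And>i. i \<in> {1..k} \<Longrightarrow> mat_analytic_at (sysN G) (\<sigma> i)"
    and "\<And>i. i \<in> {1..k} \<Longrightarrow> mat_analytic_at (sysB G) (\<sigma> i)"
    and "\<And>i. i \<in> {1..k} \<Longrightarrow> full_rank (sysK (project W V G) (\<sigma> i))"
    and "vec.span (\<Union>q\<in>{1..k}. \<Union>d\<in>{0..l (k - q + 1)}. columns (left_vec G k \<sigma> l q d))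
           \<subseteq> vec.span (columns W)"
    and "full_rank V"
  shows "(\<forall>d\<in>{0..l k}.
            mixed_deriv 1 (\<lambda>_. d) (transfer G 1) (\<lambda>_. \<sigma> k)
            = mixed_deriv 1 (\<lambda>_. d) (transfer (project W V G) 1) (\<lambda>_. \<sigma> k))
       \<and> (\<forall>q\<in>{2..k}. \<forall>d\<in>{0..l (k - q + 1)}.
            mixed_deriv q (\<lambda>i. if i = 1 then d else l (k - q + i)) (transfer G q)
              (\<lambda>i. \<sigma> (k - q + i))
            = mixed_deriv q (\<lambda>i. if i = 1 then d else l (k - q + i)) (transfer (project W V G) q)
              (\<lambda>i. \<sigma> (k - q + i)))"
proof -
  \<comment> \<open>The span inclusion factors each vector as \<open>W ** Y\<close>; its conjugate
    transpose is \<open>Y^H W^H\<close>.\<close>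
  have "\<exists>y. left_row G k \<sigma> l q d = y ** mat_herm W"
    if q: "q \<in> {1..k}" and d: "d \<le> l (k - q + 1)" for q d
  proof -
    have "columns (left_vec G k \<sigma> l q d) \<subseteq>
        (\<Union>q\<in>{1..k}. \<Union>d\<in>{0..l (k - q + 1)}. columns (left_vec G k \<sigma> l q d))"
      using q d by (intro UN_upper[THEN subset_trans[rotated]] UN_upper) auto
    then have "columns (left_vec G k \<sigma> l q d) \<subseteq> vec.span (columns W)"
      using assms(7) vec.span_superset by (meson subset_trans)
    then obtain Y where "left_vec G k \<sigma> l q d = W ** Y"
      by (rule columns_subset_span_imp_factor)
    then show ?thesis
      by (auto simp: left_row_def mat_herm_mult)
  qed
  then obtain y where y: "\<And>q d. q \<in> {1..k} \<Longrightarrow> d \<le> l (k - q + 1) \<Longrightarrow>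
      left_row G k \<sigma> l q d = y q d ** mat_herm W"
    by metis
  note an = project_analytic_at[OF assms(2-6)]
  \<comment> \<open>Arbitrary \<open>z\<close> and \<open>e\<close> with the prescribed values on
    the relevant indices cover both claims, including the constant functions used for
    \<open>q = 1\<close>.\<close>
  have main: "mixed_deriv q e (transfer G q) z = mixed_deriv q e (transfer (project W V G) q) z"
    if q: "1 \<le> q" "q \<le> k" and z: "\<And>i. i \<in> {1..q} \<Longrightarrow> z i = \<sigma> (k - q + i)"
      and e: "\<And>i. i \<in> {2..q} \<Longrightarrow> e i = l (k - q + i)" and e1: "e 1 \<le> l (k - q + 1)" for q e z
  proof -
    have kq: "k - q + 1 \<in> {1..k}"
      using q by auto
    have "left_row (project W V G) k \<sigma> l q i ** mat_deriv j (sysB (project W V G)) (\<sigma> (k - q + 1)) =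
        left_row G k \<sigma> l q i ** mat_deriv j (sysB G) (\<sigma> (k - q + 1))" if "i \<le> e 1" for i j
    proof -
      \<comment> \<open>The constant \<open>W^H\<close> in the reduced \<open>B\<close> supplies the
        right factor that the reduced row needs to become the original one.\<close>
      have "mat_deriv j (sysB (project W V G)) (\<sigma> (k - q + 1)) =
          mat_herm W ** mat_deriv j (sysB G) (\<sigma> (k - q + 1))"
        using mat_deriv_cmult_left[OF assms(5)[OF kq]] by (simp add: project_def)
      moreover have "left_row (project W V G) k \<sigma> l q i ** mat_herm W = left_row G k \<sigma> l q i"
        by (rule left_row_project[OF assms(2-6) y q]) (use that e1 in auto)
      ultimately show ?thesis
        by (simp add: matrix_mul_assoc)
    qed
    then have "(\<Sum>i\<le>e 1. real (e 1 choose i) *\<^sub>R (left_row G k \<sigma> l q i **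
          mat_deriv (e 1 - i) (sysB G) (\<sigma> (k - q + 1)))) =
        (\<Sum>i\<le>e 1. real (e 1 choose i) *\<^sub>R (left_row (project W V G) k \<sigma> l q i **
          mat_deriv (e 1 - i) (sysB (project W V G)) (\<sigma> (k - q + 1))))"
      by (intro sum.cong) auto
    moreover have "mixed_deriv q e (transfer G q) z =
        (\<Sum>i\<le>e 1. real (e 1 choose i) *\<^sub>R (left_row G k \<sigma> l q i **
          mat_deriv (e 1 - i) (sysB G) (\<sigma> (k - q + 1)))) $ 1 $ 1"
      by (rule mixed_deriv_transfer[where \<sigma> = \<sigma> and k = k and l = l])
        (use an assms(5) z e q in auto)
    moreover have "mixed_deriv q e (transfer (project W V G) q) z =
        (\<Sum>i\<le>e 1. real (e 1 choose i) *\<^sub>R (left_row (project W V G) k \<sigma> l q i **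
          mat_deriv (e 1 - i) (sysB (project W V G)) (\<sigma> (k - q + 1)))) $ 1 $ 1"
      by (rule mixed_deriv_transfer[where \<sigma> = \<sigma> and k = k and l = l])
        (use an z e q in auto)
    ultimately show ?thesis
      by simp
  qed
  show ?thesis
    by (intro conjI ballI main) (use assms(1) in auto)
qed

end
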